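(* Let $f$ be a continuously differentiable convex function with a Lipschitz continuous gradient and let $g$ be a proper, lower semicontinuous, convex function. Then the set of optimal primal-dual pairs $(x^\star,y^\star)$ of the problem $$\min_{x,z}\ f(x)+g(z)\quad\text{subject to}\quad Tx-z=0$$ is globally asymptotically stable for the gradient flow dynamics $$\dot x=-\big(\nabla f(x)+T^T\nabla M_{\mu g}(Tx+\mu y)\big),\qquad \dot y=\mu\big(\nabla M_{\mu g}(Tx+\mu y)-y\big),$$ and $x^\star$ is a solution of the problem $\min_x\ f(x)+g(Tx)$.
   Context: Here $x\in\mathbb{R}^n$, $y,z\in\mathbb{R}^m$, $T\in\mathbb{R}^{m\times n}$ is a given matrix, and $\mu>0$ is a parameter; $f$ is a real-valued function on $\mathbb{R}^n$ and $g$ is an extended-real-valued function on $\mathbb{R}^m$. Standing assumptions: the problem $\min_x f(x)+g(Tx)$ is feasible and its minimum is finite. The optimal primal-dual pairs $(x^\star,y^\star)$ of the constrained problem, whose Lagrangian is $f(x)+g(z)+\langle y,Tx-z\rangle$, are characterized by the first-order optimality conditions (together with some $z^\star$) $$0=\nabla f(x^\star)+T^Ty^\star,\qquad 0\in\partial g(z^\star)-y^\star,\qquad 0=Tx^\star-z^\star,$$ where $\partial g$ is the subdifferential of $g$. The proximal operator of $g$ is $\mathbf{prox}_{\mu g}(v)=\operatorname*{argmin}_{u}\big(g(u)+\tfrac{1}{2\mu}\|u-v\|^2\big)$, and the Moreau envelope of $g$ is $M_{\mu g}(v)=g(\mathbf{prox}_{\mu g}(v))+\tfrac{1}{2\mu}\|\mathbf{prox}_{\mu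 g}(v)-v\|^2$, which is continuously differentiable with $\nabla M_{\mu g}(v)=\tfrac1\mu\big(v-\mathbf{prox}_{\mu g}(v)\big)$. The dynamics above are $\dot x=-\nabla_x\mathcal{L}_\mu(x;y)$, $\dot y=\nabla_y\mathcal{L}_\mu(x;y)$ for the proximal augmented Lagrangian $\mathcal{L}_\mu(x;y)=f(x)+M_{\mu g}(Tx+\mu y)-\tfrac{\mu}{2}\|y\|^2$. Global asymptotic stability of a set is meant in the usual sense: the set is stable in the sense of Lyapunov and every trajectory of the dynamics, from any initial condition, converges to the set as $t\to\infty$.
   Formalization: The formal statement additionally assumes that at least one optimal primal-dual pair exists; a feasible problem with finite, attained minimum may have none, and then no trajectory can converge to the (empty) set. *)

theory Defs
  imports "HOL-Analysis.Analysis"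
begin

text \<open>Junk value where F is not differentiable.\<close>
definition gradient :: "('a::real_inner \<Rightarrow> real) \<Rightarrow> 'a \<Rightarrow> 'a" where
  "gradient F x = (THE D. GDERIV F x :> D)"

definition continuously_differentiable :: "('a::real_inner \<Rightarrow> real) \<Rightarrow> bool" where
  "continuously_differentiable F \<longleftrightarrow>
     (\<forall>x. \<exists>D. GDERIV F x :> D) \<and> continuous_on UNIV (gradient F)"

definition proper :: "('a \<Rightarrow> ereal) \<Rightarrow> bool" where
  "proper g \<longleftrightarrow> (\<forall>z. g z \<noteq> - \<infinity>) \<and> (\<exists>z. g z \<noteq> \<infinity>)"

definition lower_semicontinuous :: "('a::topological_space \<Rightarrow> ereal) \<Rightarrow> bool" where
  "lower_semicontinuous g \<longleftrightarrow> (\<forall>z. g z \<le> Liminf (at z) g)"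

text \<open>Convexity of an extended-real-valued function, as convexity of its epigraph. The library's
  constants \<^term>\<open>convex_on\<close> and \<^term>\<open>epigraph\<close> are for real-valued functions only.\<close>
definition ereal_convex :: "('a::real_vector \<Rightarrow> ereal) \<Rightarrow> bool" where
  "ereal_convex g \<longleftrightarrow> convex {(z, r::real). g z \<le> ereal r}"

definition subdifferential :: "('a::real_inner \<Rightarrow> ereal) \<Rightarrow> 'a \<Rightarrow> 'a set" where
  "subdifferential g z = {s. \<forall>w. g z + ereal (s \<bullet> (w - z)) \<le> g w}"

definition prox :: "real \<Rightarrow> ('a::real_inner \<Rightarrow> ereal) \<Rightarrow> 'a \<Rightarrow> 'a" where
  "prox \<mu> g v = (ARG_MIN (\<lambda>u. g u + ereal (1 / (2 * \<mu>) * (norm (u - v))\<^sup>2)) u. True)"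

text \<open>The value is always finite when g is proper, lower semicontinuous and convex, so that
  \<^term>\<open>real_of_ereal\<close> loses nothing.\<close>
definition moreau_envelope :: "real \<Rightarrow> ('a::real_inner \<Rightarrow> ereal) \<Rightarrow> 'a \<Rightarrow> real" where
  "moreau_envelope \<mu> g v =
     real_of_ereal (g (prox \<mu> g v) + ereal (1 / (2 * \<mu>) * (norm (prox \<mu> g v - v))\<^sup>2))"

text \<open>First-order optimality conditions for minimizing f x + g z subject to T x - z = 0.\<close>
definition optimal_pairs ::
    "(real^'n \<Rightarrow> real) \<Rightarrow> (real^'m \<Rightarrow> ereal) \<Rightarrow> real^'n^'m \<Rightarrow> ((real^'n) \<times> (real^'m)) set" where
  "optimal_pairs f g T =
     {(x, y). \<exists>z. 0 = gradient f x + transpose T *v y \<and>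
                  0 \<in> (\<lambda>s. s - y) ` subdifferential g z \<and>
                  0 = T *v x - z}"

definition flow_field ::
    "real \<Rightarrow> (real^'n \<Rightarrow> real) \<Rightarrow> (real^'m \<Rightarrow> ereal) \<Rightarrow> real^'n^'m \<Rightarrow>
     (real^'n) \<times> (real^'m) \<Rightarrow> (real^'n) \<times> (real^'m)" where
  "flow_field \<mu> f g T = (\<lambda>(x, y).
     let d = gradient (moreau_envelope \<mu> g) (T *v x + \<mu> *\<^sub>R y)
     in (- (gradient f x + transpose T *v d), \<mu> *\<^sub>R (d - y)))"

definition trajectory :: "('a::real_normed_vector \<Rightarrow> 'a) \<Rightarrow> (real \<Rightarrow> 'a) \<Rightarrow> bool" where
  "trajectory F p \<longleftrightarrow>
     (\<forall>t\<ge>0. (p has_vector_derivative F (p t)) (at t within {0..}))"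

definition lyapunov_stable :: "('a::real_normed_vector \<Rightarrow> 'a) \<Rightarrow> 'a set \<Rightarrow> bool" where
  "lyapunov_stable F S \<longleftrightarrow>
     (\<forall>\<epsilon>>0. \<exists>\<delta>>0. \<forall>p. trajectory F p \<longrightarrow> infdist (p 0) S < \<delta> \<longrightarrow>
        (\<forall>t\<ge>0. infdist (p t) S < \<epsilon>))"

text \<open>Nonemptiness is required explicitly because \<^term>\<open>infdist\<close> to the empty set is 0,
  whereas no trajectory converges to the empty set.\<close>
definition globally_asymptotically_stable ::
    "('a::real_normed_vector \<Rightarrow> 'a) \<Rightarrow> 'a set \<Rightarrow> bool" where
  "globally_asymptotically_stable F S \<longleftrightarrow>
     S \<noteq> {} \<and> lyapunov_stable F S \<and>
     (\<forall>p. trajectory F p \<longrightarrow> ((\<lambda>t. infdist (p t) S) \<longlongrightarrow> 0) at_top)"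

end

theory Submission
  imports Defs
begin

text \<open>Zeros of the flow field are exactly the optimal pairs. For an optimal pair \<open>w*\<close> and
  \<open>d = \<nabla>M(T x + \<mu> y)\<close>, which is a subgradient of \<open>g\<close> at \<open>T x - \<mu> (d - y)\<close>, monotonicity
  of the subdifferential bounds the derivative of \<open>\<parallel>w - w*\<parallel>\<^sup>2 / 2\<close> along the flow by
  \<open>- \<langle>\<nabla>f x - \<nabla>f x*, x - x*\<rangle> - \<mu> \<parallel>d - y\<parallel>\<^sup>2\<close>. This gives stability, and with cocoercivity of
  \<open>\<nabla>f\<close> and Barbalat's argument it shows \<open>\<nabla>f x \<rightarrow> \<nabla>f x*\<close> and \<open>d - y \<rightarrow> 0\<close>. Hence the velocity of \<open>y\<close>
  tends to 0, that of \<open>x\<close> becomes slowly varying, and since \<open>x\<close> is bounded it tends to 0 too.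
  So every limit point of a trajectory is a zero of the field.\<close>

section \<open>Gradients and convexity\<close>

lemma gradient_eqI:
  assumes "GDERIV F x :> D"
  shows "gradient F x = D"
proof -
  have "D' = D" if "GDERIV F x :> D'" for D'
  proof -
    have "(\<lambda>h. h \<bullet> D') = (\<lambda>h. h \<bullet> D)"
      using that assms unfolding gderiv_def by (rule has_derivative_unique)
    then have "(D' - D) \<bullet> D' = (D' - D) \<bullet> D" by meson
    then have "(D' - D) \<bullet> (D' - D) = 0" by (simp add: inner_diff_right)
    then show ?thesis by simp
  qed
  then show ?thesis
    unfolding gradient_def using assms by blast
qed

lemma continuously_differentiable_GDERIV:
  "continuously_differentiable F \<Longrightarrow> GDERIV F x :> gradient F x"
  unfolding continuously_differentiable_def using gradient_eqI by metis

text \<open>Dividing the quadratic remainder by \<open>norm (w - v)\<close> leaves a term that tends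
  to 0. This serves the Moreau envelope, where such a bound is available without differentiating
  \<open>prox\<close>.\<close>

lemma GDERIV_quadratic_boundI:
  assumes "\<And>w. \<bar>F w - F v - D \<bullet> (w - v)\<bar> \<le> C * (norm (w - v))\<^sup>2"
  shows "GDERIV F v :> D"
  unfolding gderiv_def
proof (rule has_derivativeI_sandwich[where e=1 and H="\<lambda>w. C * norm (w - v)"])
  show "bounded_linear (\<lambda>h. h \<bullet> D)" by (rule bounded_linear_inner_left)
  show "norm (F w - F v - (w - v) \<bullet> D) / norm (w - v) \<le> C * norm (w - v)"
    if "w \<noteq> v" for w
    using assms[of w] that by (simp add: inner_commute divide_simps power2_eq_square)
  show "((\<lambda>w. C * norm (w - v)) \<longlongrightarrow> 0) (at v)"
    by (auto intro!: tendsto_eq_intros)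
qed simp

text \<open>Restricting \<open>f\<close> to the line through \<open>x\<close> and \<open>y\<close>
  reduces this to the tangent inequality for convex functions of one real variable.\<close>

lemma convex_on_above_tangent_gradient:
  assumes "convex_on UNIV f" and D: "GDERIV f x :> D"
  shows "f x + D \<bullet> (y - x) \<le> f y"
proof -
  define k where "k t = f (x + t *\<^sub>R (y - x))" for t :: real
  have "convex_on UNIV k"
  proof (rule convex_onI)
    fix t a b :: real assume t: "0 < t" "t < 1"
    have "x + ((1 - t) *\<^sub>R a + t *\<^sub>R b) *\<^sub>R (y - x)
        = (1 - t) *\<^sub>R (x + a *\<^sub>R (y - x)) + t *\<^sub>R (x + b *\<^sub>R (y - x))"
      by (simp add: algebra_simps)
    then show "k ((1 - t) *\<^sub>R a + t *\<^sub>R b) \<le> (1 - t) * k a + t * k b"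
      unfolding k_def using convex_onD[OF assms(1), of t] t by simp
  qed simp
  moreover have "(k has_real_derivative D \<bullet> (y - x)) (at 0)"
  proof -
    have "((\<lambda>t::real. x + t *\<^sub>R (y - x)) has_derivative (\<lambda>t. t *\<^sub>R (y - x))) (at 0)"
      by (auto intro!: derivative_eq_intros)
    moreover have "(f has_derivative (\<lambda>h. h \<bullet> D)) (at (x + (0::real) *\<^sub>R (y - x)))"
      using D by (simp add: gderiv_def)
    ultimately have "(k has_derivative (\<lambda>t. (t *\<^sub>R (y - x)) \<bullet> D)) (at 0)"
      unfolding k_def by (rule has_derivative_compose)
    then show ?thesis
      unfolding has_field_derivative_def
      by (rule has_derivative_eq_rhs) (auto simp: inner_commute mult.commute)
  qed
  ultimately have "k 1 - k 0 \<ge> (D \<bullet> (y - x)) * (1 - 0)"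
    by (intro convex_on_imp_above_tangent[where A=UNIV]) auto
  then show ?thesis by (simp add: k_def)
qed

text \<open>The point \<^term>\<open>z\<close> below is a gradient step from \<^term>\<open>x\<close> for the function
  \<^term>\<open>\<lambda>u. f u - F y \<bullet> u\<close>, which is minimal at \<^term>\<open>y\<close>.\<close>
lemma gradient_cocoercive:
  assumes f: "convex_on UNIV f" "\<And>x. GDERIV f x :> F x"
    and lip: "L-lipschitz_on UNIV F" and "L > 0"
  shows "(norm (F x - F y))\<^sup>2 \<le> 4 * L * ((F x - F y) \<bullet> (x - y))"
proof -
  define r where "r = F x - F y"
  define z where "z = x - (1 / (2 * L)) *\<^sub>R r"
  have tangent: "f a + F a \<bullet> (b - a) \<le> f b" for a b
    using convex_on_above_tangent_gradient[OF f(1) f(2)] .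
  \<comment> \<open>In the sum of these three tangent inequalities all values of \<open>f\<close>
    cancel, and only gradient terms remain.\<close>
  have "f y + F y \<bullet> (z - y) \<le> f z" "f z + F z \<bullet> (x - z) \<le> f x" "f x + F x \<bullet> (y - x) \<le> f y"
    by (rule tangent)+
  then have 1: "(F z - F y) \<bullet> (x - z) \<le> r \<bullet> (x - y)"
    by (simp add: r_def inner_diff_left inner_diff_right)
  have xz: "x - z = (1 / (2 * L)) *\<^sub>R r" by (simp add: z_def)
  \<comment> \<open>The step size \<open>1 / (2 * L)\<close> is chosen so that \<open>F z\<close>
    differs from \<open>F x\<close> by at most half of \<open>norm r\<close>; hence
    \<open>F z - F y\<close> retains at least half of \<open>r\<close> in the direction of
    \<open>r\<close>.\<close>
  have "norm (F x - F z) \<le> L * norm (x - z)"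
    using lipschitz_on_normD[OF lip] by auto
  also have "\<dots> = norm r / 2"
    using \<open>L > 0\<close> by (simp add: xz)
  finally have "norm (F x - F z) * norm r \<le> norm r / 2 * norm r"
    by (intro mult_right_mono) auto
  moreover have "(F x - F z) \<bullet> r \<le> norm (F x - F z) * norm r"
    by (rule norm_cauchy_schwarz)
  moreover have "(F z - F y) \<bullet> r = r \<bullet> r - (F x - F z) \<bullet> r"
    by (simp add: r_def inner_diff_left)
  ultimately have "(F z - F y) \<bullet> r \<ge> (norm r)\<^sup>2 / 2"
    by (simp add: power2_norm_eq_inner[symmetric] power2_eq_square)
  then have "(norm r)\<^sup>2 / 2 / (2 * L) \<le> (F z - F y) \<bullet> (x - z)"
    using \<open>L > 0\<close> by (simp add: xz divide_simps)
  with 1 have "(norm r)\<^sup>2 / 2 / (2 * L) \<le> r \<bullet> (x - y)" by simp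
  then show ?thesis
    using \<open>L > 0\<close> by (simp add: r_def divide_simps mult_ac)
qed

section \<open>Proximal operator and Moreau envelope\<close>

lemma subdifferentialD: "s \<in> subdifferential g z \<Longrightarrow> g z + ereal (s \<bullet> (w - z)) \<le> g w"
  by (simp add: subdifferential_def)

lemma subdifferential_finite:
  assumes "proper g" "s \<in> subdifferential g z"
  shows "\<bar>g z\<bar> \<noteq> \<infinity>"
proof -
  obtain w where "g w \<noteq> \<infinity>" using assms(1) by (auto simp: proper_def)
  with subdifferentialD[OF assms(2), of w] have "g z \<noteq> \<infinity>" by auto
  with assms(1) show ?thesis by (auto simp: proper_def)
qed

text \<open>The two subgradient inequalities are added; the values of \<open>g\<close> cancel
  because they are finite wherever a subgradient exists.\<close>

lemma subdifferential_monotone: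
  assumes g: "proper g" and s: "s \<in> subdifferential g z" and s': "s' \<in> subdifferential g z'"
  shows "(s - s') \<bullet> (z - z') \<ge> 0"
proof -
  obtain a b where "g z = ereal a" "g z' = ereal b"
    using subdifferential_finite[OF g s] subdifferential_finite[OF g s'] by auto
  with subdifferentialD[OF s, of z'] subdifferentialD[OF s', of z]
  have "a + s \<bullet> (z' - z) \<le> b" "b + s' \<bullet> (z - z') \<le> a" by auto
  then show ?thesis by (simp add: inner_diff_left inner_diff_right)
qed

section \<open>Lower semicontinuity and attainment of minima\<close>

lemma lower_semicontinuous_open:
  assumes "lower_semicontinuous g"
  shows "open {z. c < g z}"
proof -
  have "eventually (\<lambda>w. c < g w) (nhds z)" if "c < g z" for z
  proof -
    have "g z \<le> Liminf (at z) g" using assms by (simp add: lower_semicontinuous_def)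
    with that have "eventually (\<lambda>w. c < g w) (at z)" by (auto simp: le_Liminf_iff)
    with that show ?thesis by (simp add: eventually_nhds_conv_at)
  qed
  then show ?thesis
    by (subst open_subopen) (force simp: eventually_nhds)
qed

text \<open>The sum exceeds \<open>c\<close> at \<open>z\<close> exactly when some real
  \<open>b\<close> lies strictly between \<open>c - q z\<close> and \<open>g z\<close>, so the set
  is a union of intersections of two open sets.\<close>

lemma lower_semicontinuous_add_continuous_open:
  assumes "lower_semicontinuous g" and q: "continuous_on UNIV q"
  shows "open {z. ereal c < g z + ereal (q z)}"
proof -
  have "{z. ereal c < g z + ereal (q z)} = (\<Union>b. {z. c - q z < b} \<inter> {z. ereal b < g z})"
  proof (intro set_eqI iffI)
    fix z assume "z \<in> {z. ereal c < g z + ereal (q z)}"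
    then have "ereal (c - q z) < g z" by (cases "g z") auto
    then obtain b where "ereal (c - q z) < ereal b" "ereal b < g z"
      using ereal_dense2 by blast
    then show "z \<in> (\<Union>b. {z. c - q z < b} \<inter> {z. ereal b < g z})" by auto
  next
    fix z assume "z \<in> (\<Union>b. {z. c - q z < b} \<inter> {z. ereal b < g z})"
    then show "z \<in> {z. ereal c < g z + ereal (q z)}" by (cases "g z") auto
  qed
  moreover have "open {z. c - q z < b}" for b
    by (intro open_Collect_less continuous_intros q)
  ultimately show ?thesis
    using lower_semicontinuous_open[OF assms(1)] by (auto intro!: open_UN open_Int)
qed

text \<open>Without a minimum, the open sets \<open>{x. h u < h x}\<close> would cover
  \<open>C\<close>. In a finite subcover, the index \<open>u\<close> with least value
  \<open>h u\<close> belongs to none of the sets.\<close>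

lemma compact_attains_minimum_lsc:
  fixes h :: "'a::topological_space \<Rightarrow> 'b::linorder"
  assumes C: "compact C" "C \<noteq> {}" and op: "\<And>u. u \<in> C \<Longrightarrow> open {x. h u < h x}"
  shows "\<exists>u\<in>C. \<forall>x\<in>C. h u \<le> h x"
proof (rule ccontr)
  assume no_min: "\<not> ?thesis"
  have "C \<subseteq> (\<Union>u\<in>C. {x. h u < h x})" using no_min by force
  then obtain D where D: "D \<subseteq> C" "finite D" "C \<subseteq> (\<Union>u\<in>D. {x. h u < h x})"
    using compactE_image[OF C(1), of C "\<lambda>u. {x. h u < h x}"] op by metis
  with C(2) have "D \<noteq> {}" by auto
  with D(2) obtain u where "u \<in> D" "\<forall>w\<in>D. h u \<le> h w"
    using finite_has_minimal[of "h ` D"] by (metis (no_types, lifting) finite_imageI image_iff image_is_empty linorder_linear)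
  with D show False by force
qed

text \<open>The subgradient \<open>s\<close> gives an affine minorant of \<open>g\<close>. The
  quadratic term dominates it, so the sublevel set \<open>C\<close> through \<open>z\<close> is
  compact and a minimum over \<open>C\<close> is global.\<close>

lemma prox_minimizer_exists:
  fixes g :: "'a::euclidean_space \<Rightarrow> ereal"
  assumes "\<mu> > 0" and g: "proper g" "lower_semicontinuous g" and s: "s \<in> subdifferential g z"
  shows "\<exists>p. \<forall>u. g p + ereal (1 / (2 * \<mu>) * (norm (p - v))\<^sup>2)
               \<le> g u + ereal (1 / (2 * \<mu>) * (norm (u - v))\<^sup>2)"
proof -
  define q where "q u = 1 / (2 * \<mu>) * (norm (u - v))\<^sup>2" for u
  define h where "h u = g u + ereal (q u)" for u
  obtain a where a: "g z = ereal a"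
    using subdifferential_finite[OF g(1) s] by auto
  define C where "C = {u. h u \<le> h z}"
  have hz: "h z = ereal (a + q z)" by (simp add: h_def a)
  have op: "open {x. ereal c < h x}" for c
    unfolding h_def
    by (intro lower_semicontinuous_add_continuous_open g) (use assms(1) in \<open>auto simp: q_def intro!: continuous_intros\<close>)
  \<comment> \<open>Openness in \<open>op\<close> is stated for real thresholds, so the values of
    \<open>h\<close> on \<open>C\<close> must be real.\<close>
  have real: "\<exists>c. h u = ereal c" if "u \<in> C" for u
  proof -
    have "h u \<noteq> - \<infinity>" using g(1) by (simp add: h_def proper_def)
    with that show ?thesis by (cases "h u") (auto simp: C_def hz)
  qed
  have "closed C"
    using op[of "a + q z"] by (simp add: C_def hz closed_def Compl_eq not_le)
  moreover have "bounded C"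
  proof (rule boundedI)
    fix u assume "u \<in> C"
    then have "g u + ereal (q u) \<le> ereal (a + q z)" unfolding C_def hz by (simp add: h_def)
    moreover have "ereal a + ereal (s \<bullet> (u - z)) \<le> g u"
      using subdifferentialD[OF s, of u] by (simp add: a)
    ultimately have 1: "s \<bullet> (u - z) + q u \<le> q z" by (cases "g u") auto
    have "- (norm s * norm (u - z)) \<le> s \<bullet> (u - z)"
      using Cauchy_Schwarz_ineq2[of s "u - z"] by linarith
    moreover have "norm s * norm (u - z) \<le> norm s * (norm (u - v) + norm (z - v))"
      by (intro mult_left_mono) (use norm_triangle_ineq4[of "u - v" "z - v"] in auto)
    \<comment> \<open>Expanding this square is Young's inequality: the linear term is absorbed by
      half of \<open>q u\<close>, leaving the other half to bound \<open>u\<close>.\<close>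
    moreover have "0 \<le> (norm (u - v) - 2 * \<mu> * norm s)\<^sup>2 / (4 * \<mu>)"
      using \<open>\<mu> > 0\<close> by simp
    then have "norm s * norm (u - v) \<le> q u / 2 + \<mu> * (norm s)\<^sup>2"
      using \<open>\<mu> > 0\<close> by (simp add: q_def power2_eq_square field_simps)
    ultimately have "q u / 2 \<le> q z + norm s * norm (z - v) + \<mu> * (norm s)\<^sup>2"
      using 1 by (simp add: algebra_simps)
    then have "4 * \<mu> * (q u / 2) \<le> 4 * \<mu> * (q z + norm s * norm (z - v) + \<mu> * (norm s)\<^sup>2)"
      using \<open>\<mu> > 0\<close> by (intro mult_left_mono) auto
    moreover have "4 * \<mu> * (q u / 2) = (norm (u - v))\<^sup>2"
      using \<open>\<mu> > 0\<close> by (simp add: q_def)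
    ultimately have "(norm (u - v))\<^sup>2 \<le> 4 * \<mu> * (q z + norm s * norm (z - v) + \<mu> * (norm s)\<^sup>2)"
      by (simp only:)
    then have "norm (u - v) \<le> sqrt (4 * \<mu> * (q z + norm s * norm (z - v) + \<mu> * (norm s)\<^sup>2))"
      by (rule real_le_rsqrt)
    then show "norm u \<le> norm v + sqrt (4 * \<mu> * (q z + norm s * norm (z - v) + \<mu> * (norm s)\<^sup>2))"
      using norm_triangle_sub[of u v] by linarith
  qed
  ultimately have "compact C" by (simp add: compact_eq_bounded_closed)
  moreover have "z \<in> C" by (simp add: C_def)
  ultimately obtain p where "p \<in> C" "\<forall>u\<in>C. h p \<le> h u"
    using compact_attains_minimum_lsc[of C h] op real by (metis empty_iff)
  then have "h p \<le> h u" for u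
    unfolding C_def by (metis (mono_tags) mem_Collect_eq linorder_le_cases order_trans)
  then show ?thesis unfolding h_def q_def by blast
qed

section \<open>The proximal point and the gradient of the envelope\<close>

lemma prox_le:
  fixes g :: "'a::euclidean_space \<Rightarrow> ereal"
  assumes "\<mu> > 0" "proper g" "lower_semicontinuous g" "s \<in> subdifferential g z"
  shows "g (prox \<mu> g v) + ereal (1 / (2 * \<mu>) * (norm (prox \<mu> g v - v))\<^sup>2)
           \<le> g u + ereal (1 / (2 * \<mu>) * (norm (u - v))\<^sup>2)"
proof -
  let ?h = "\<lambda>u. g u + ereal (1 / (2 * \<mu>) * (norm (u - v))\<^sup>2)"
  have "\<exists>p. is_arg_min ?h (\<lambda>_. True) p"
    using prox_minimizer_exists[OF assms, of v] by (auto simp: is_arg_min_linorder)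
  then have "is_arg_min ?h (\<lambda>_. True) (prox \<mu> g v)"
    unfolding prox_def arg_min_def by (rule someI_ex)
  then show ?thesis by (simp add: is_arg_min_linorder)
qed

text \<open>Fermat's rule for the proximal problem: the minimizer \<open>p\<close> is compared with
  points \<open>u\<close> on the segment towards \<open>w\<close>, convexity bounds
  \<open>g u\<close>, and after division by \<open>t\<close> the limit \<open>t\<close> to 0 removes
  the quadratic remainder.\<close>

lemma prox_subdifferential:
  fixes g :: "'a::euclidean_space \<Rightarrow> ereal"
  assumes "\<mu> > 0" and g: "proper g" "lower_semicontinuous g" "ereal_convex g"
    and s: "s \<in> subdifferential g z"
  shows "(1 / \<mu>) *\<^sub>R (v - prox \<mu> g v) \<in> subdifferential g (prox \<mu> g v)"
proof -
  define p where "p = prox \<mu> g v"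
  have min: "g p + ereal (1 / (2 * \<mu>) * (norm (p - v))\<^sup>2)
           \<le> g u + ereal (1 / (2 * \<mu>) * (norm (u - v))\<^sup>2)" for u
    unfolding p_def using prox_le[OF assms(1) g(1,2) s] .
  obtain a where a: "g p = ereal a"
    using min[of z] g(1) subdifferential_finite[OF g(1) s]
    by (cases "g p") (auto simp: proper_def)
  have "g p + ereal (((1 / \<mu>) *\<^sub>R (v - p)) \<bullet> (w - p)) \<le> g w" for w
  proof (cases "g w")
    case (real b)
    have "a + ((1 / \<mu>) *\<^sub>R (v - p)) \<bullet> (w - p) - b \<le> t * ((norm (w - p))\<^sup>2 / (2 * \<mu>))"
      if t: "0 < t" "t < 1" for t
    proof -
      define u where "u = (1 - t) *\<^sub>R p + t *\<^sub>R w"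
      have "(1 - t) *\<^sub>R (p, a) + t *\<^sub>R (w, b) \<in> {(z, r::real). g z \<le> ereal r}"
        using g(3) t unfolding ereal_convex_def
        by (intro convexD) (auto simp: a real)
      then have "g u \<le> ereal ((1 - t) * a + t * b)" by (simp add: u_def)
      then have "g u + ereal (1 / (2 * \<mu>) * (norm (u - v))\<^sup>2)
          \<le> ereal ((1 - t) * a + t * b) + ereal (1 / (2 * \<mu>) * (norm (u - v))\<^sup>2)"
        by (rule add_right_mono)
      from order_trans[OF min[of u] this] have "a + 1 / (2 * \<mu>) * (norm (p - v))\<^sup>2
          \<le> (1 - t) * a + t * b + 1 / (2 * \<mu>) * (norm (u - v))\<^sup>2"
        by (simp add: a)
      moreover have "u - v = (p - v) + t *\<^sub>R (w - p)" by (simp add: u_def algebra_simps)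
      then have "(norm (u - v))\<^sup>2 = (norm (p - v))\<^sup>2 + 2 * t * ((p - v) \<bullet> (w - p)) + t\<^sup>2 * (norm (w - p))\<^sup>2"
        by (simp only: power2_norm_eq_inner)
          (simp add: inner_add_left inner_add_right inner_commute power2_eq_square)
      ultimately have "t * (a - b) \<le> 1 / (2 * \<mu>) * (2 * t * ((p - v) \<bullet> (w - p)) + t\<^sup>2 * (norm (w - p))\<^sup>2)"
        by (simp add: algebra_simps)
      also have "\<dots> = t * (1 / \<mu> * ((p - v) \<bullet> (w - p)) + t * ((norm (w - p))\<^sup>2 / (2 * \<mu>)))"
        using \<open>\<mu> > 0\<close> by (simp add: field_simps power2_eq_square)
      finally have "a - b \<le> 1 / \<mu> * ((p - v) \<bullet> (w - p)) + t * ((norm (w - p))\<^sup>2 / (2 * \<mu>))"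
        using t by simp
      moreover have "(v - p) \<bullet> (w - p) = - ((p - v) \<bullet> (w - p))"
        by (simp add: inner_diff_left)
      ultimately show ?thesis by simp
    qed
    then have "eventually (\<lambda>t. a + ((1 / \<mu>) *\<^sub>R (v - p)) \<bullet> (w - p) - b \<le> t * ((norm (w - p))\<^sup>2 / (2 * \<mu>)))
        (at_right 0)"
      by (auto simp: eventually_at_right_field intro!: exI[of _ 1])
    moreover have "((\<lambda>t. t * ((norm (w - p))\<^sup>2 / (2 * \<mu>))) \<longlongrightarrow> 0) (at_right 0)"
      using \<open>\<mu> > 0\<close> by (auto intro!: tendsto_eq_intros)
    ultimately have "a + ((1 / \<mu>) *\<^sub>R (v - p)) \<bullet> (w - p) - b \<le> 0"
      by (intro tendsto_lowerbound[where F="at_right (0::real)"]) auto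
    then show ?thesis by (simp add: a real)
  qed (use g(1) in \<open>auto simp: proper_def\<close>)
  then show ?thesis unfolding p_def[symmetric] by (simp add: subdifferential_def)
qed

text \<open>Both \<open>s\<close> at \<open>p\<close> and the residual at \<open>p'\<close> are
  subgradients; they differ by a negative multiple of \<open>p - p'\<close>, so monotonicity forces
  \<open>p = p'\<close>.\<close>

lemma prox_eqI:
  fixes g :: "'a::euclidean_space \<Rightarrow> ereal"
  assumes "\<mu> > 0" and g: "proper g" "lower_semicontinuous g" "ereal_convex g"
    and s: "s \<in> subdifferential g p"
  shows "prox \<mu> g (p + \<mu> *\<^sub>R s) = p"
proof -
  define p' where "p' = prox \<mu> g (p + \<mu> *\<^sub>R s)"
  have "(s - (1 / \<mu>) *\<^sub>R (p + \<mu> *\<^sub>R s - p')) \<bullet> (p - p') \<ge> 0"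
    unfolding p'_def by (rule subdifferential_monotone[OF g(1) s prox_subdifferential[OF assms]])
  moreover have "s - (1 / \<mu>) *\<^sub>R (p + \<mu> *\<^sub>R s - p') = - (1 / \<mu>) *\<^sub>R (p - p')"
    using \<open>\<mu> > 0\<close> by (simp add: algebra_simps)
  ultimately have "(p - p') \<bullet> (p - p') \<le> 0"
    using \<open>\<mu> > 0\<close> by (simp add: divide_simps split: if_splits)
  then have "p - p' = 0" by (metis inner_gt_zero_iff not_le)
  then show ?thesis by (simp add: p'_def)
qed

text \<open>The residual \<open>G u\<close> is a subgradient at \<open>P u\<close>. Monotonicity
  therefore makes \<open>G\<close> cocoercive with constant \<open>\<mu>\<close>, and Cauchy-Schwarz
  turns this into a Lipschitz bound.\<close>

lemma prox_residual_lipschitz: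
  fixes g :: "'a::euclidean_space \<Rightarrow> ereal"
  assumes "\<mu> > 0" and g: "proper g" "lower_semicontinuous g" "ereal_convex g"
    and s: "s \<in> subdifferential g z"
  shows "norm ((1 / \<mu>) *\<^sub>R (w - prox \<mu> g w) - (1 / \<mu>) *\<^sub>R (v - prox \<mu> g v)) \<le> norm (w - v) / \<mu>"
proof -
  define P where "P = prox \<mu> g"
  define G where "G u = (1 / \<mu>) *\<^sub>R (u - P u)" for u
  have sub: "G u \<in> subdifferential g (P u)" for u
    unfolding G_def P_def by (rule prox_subdifferential[OF assms])
  have "P w - P v = (w - v) - \<mu> *\<^sub>R (G w - G v)"
    using \<open>\<mu> > 0\<close> by (simp add: G_def algebra_simps)
  then have "0 \<le> (G w - G v) \<bullet> ((w - v) - \<mu> *\<^sub>R (G w - G v))"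
    using subdifferential_monotone[OF g(1) sub sub, of w v] by simp
  then have "\<mu> * (norm (G w - G v))\<^sup>2 \<le> (G w - G v) \<bullet> (w - v)"
    by (simp only: inner_diff_right[of "G w - G v" "w - v"] inner_scaleR_right power2_norm_eq_inner)
  also have "\<dots> \<le> norm (G w - G v) * norm (w - v)" by (rule norm_cauchy_schwarz)
  finally have "norm (G w - G v) * (\<mu> * norm (G w - G v)) \<le> norm (G w - G v) * norm (w - v)"
    by (simp add: power2_eq_square mult_ac)
  then have "\<mu> * norm (G w - G v) \<le> norm (w - v)"
    by (cases "norm (G w - G v) = 0") auto
  then have "norm (G w - G v) \<le> norm (w - v) / \<mu>"
    using \<open>\<mu> > 0\<close> by (simp add: field_simps)
  then show ?thesis by (simp only: G_def P_def)
qed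

lemma gradient_moreau_envelope:
  fixes g :: "'a::euclidean_space \<Rightarrow> ereal"
  assumes "\<mu> > 0" and g: "proper g" "lower_semicontinuous g" "ereal_convex g"
    and s: "s \<in> subdifferential g z"
  shows "gradient (moreau_envelope \<mu> g) v = (1 / \<mu>) *\<^sub>R (v - prox \<mu> g v)"
proof -
  define P where "P = prox \<mu> g"
  define G where "G w = (1 / \<mu>) *\<^sub>R (w - P w)" for w
  have sub: "G w \<in> subdifferential g (P w)" for w
    unfolding G_def P_def by (rule prox_subdifferential[OF assms])
  have fin: "g (P w) = ereal (real_of_ereal (g (P w)))" for w
    using subdifferential_finite[OF g(1) sub] by (simp add: ereal_real)
  have M: "moreau_envelope \<mu> g w = real_of_ereal (g (P w)) + 1 / (2 * \<mu>) * (norm (P w - w))\<^sup>2" for w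
    unfolding moreau_envelope_def P_def[symmetric] by (subst fin) simp
  \<comment> \<open>The proximal point of \<open>a\<close> is a competitor in the minimization that
    defines the envelope at \<open>b\<close>.\<close>
  have upper: "moreau_envelope \<mu> g b - moreau_envelope \<mu> g a
      \<le> G a \<bullet> (b - a) + 1 / (2 * \<mu>) * (norm (b - a))\<^sup>2" for a b
  proof -
    have "moreau_envelope \<mu> g b \<le> real_of_ereal (g (P a)) + 1 / (2 * \<mu>) * (norm (P a - b))\<^sup>2"
      using prox_le[OF assms(1) g(1,2) s, of b "P a"] unfolding M P_def[symmetric]
      by (subst (asm) (1 2) fin) simp
    moreover have "P a - b = (P a - a) - (b - a)" by simp
    then have "(norm (P a - b))\<^sup>2 = (norm (P a - a))\<^sup>2 + 2 * ((a - P a) \<bullet> (b - a)) + (norm (b - a))\<^sup>2"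
      by (simp only: power2_norm_eq_inner) (simp add: inner_diff_left inner_diff_right inner_commute)
    moreover have "G a \<bullet> (b - a) = 1 / (2 * \<mu>) * (2 * ((a - P a) \<bullet> (b - a)))"
      unfolding G_def by simp
    ultimately show ?thesis by (simp only: M distrib_left)
  qed
  \<comment> \<open>The lower bound is \<open>upper\<close> with the points exchanged, which
    involves \<open>G w\<close> instead of \<open>G v\<close>. Replacing it costs
    \<open>1 / \<mu>\<close> by the Lipschitz bound; adding \<open>1 / (2 * \<mu>)\<close> gives the
    constant.\<close>
  have "\<bar>moreau_envelope \<mu> g w - moreau_envelope \<mu> g v - G v \<bullet> (w - v)\<bar>
      \<le> (3 / (2 * \<mu>)) * (norm (w - v))\<^sup>2" for w
  proof -
    have "norm (G w - G v) \<le> norm (w - v) / \<mu>"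
      unfolding G_def P_def by (rule prox_residual_lipschitz[OF assms])
    then have "norm (G w - G v) * norm (w - v) \<le> norm (w - v) / \<mu> * norm (w - v)"
      by (intro mult_right_mono) auto
    with Cauchy_Schwarz_ineq2[of "G w - G v" "w - v"]
    have "\<bar>(G w - G v) \<bullet> (w - v)\<bar> \<le> (norm (w - v))\<^sup>2 / \<mu>"
      by (simp add: power2_eq_square)
    then have "\<bar>G w \<bullet> (w - v) - G v \<bullet> (w - v)\<bar> \<le> (norm (w - v))\<^sup>2 / \<mu>"
      by (simp only: inner_diff_left)
    moreover have "G w \<bullet> (v - w) = - (G w \<bullet> (w - v))"
      by (simp add: inner_diff_right)
    moreover have "moreau_envelope \<mu> g v - moreau_envelope \<mu> g w
        \<le> G w \<bullet> (v - w) + 1 / (2 * \<mu>) * (norm (w - v))\<^sup>2"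
      using upper[where a=w and b=v] by (simp only: norm_minus_commute)
    moreover have "(norm (w - v))\<^sup>2 / \<mu> \<ge> 0" using \<open>\<mu> > 0\<close> by simp
    ultimately have "\<bar>moreau_envelope \<mu> g w - moreau_envelope \<mu> g v - G v \<bullet> (w - v)\<bar>
        \<le> (norm (w - v))\<^sup>2 / \<mu> + 1 / (2 * \<mu>) * (norm (w - v))\<^sup>2"
      using upper[where a=v and b=w] unfolding abs_le_iff by linarith
    then show ?thesis using \<open>\<mu> > 0\<close> by (simp add: field_simps)
  qed
  then have "GDERIV (moreau_envelope \<mu> g) v :> G v" by (rule GDERIV_quadratic_boundI)
  then show ?thesis by (auto simp: G_def P_def dest: gradient_eqI)
qed

section \<open>Asymptotics of bounded trajectories\<close>

lemma antimono_on_bounded_below_convergent: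
  fixes V :: "real \<Rightarrow> real"
  assumes dec: "\<And>s t. 0 \<le> s \<Longrightarrow> s \<le> t \<Longrightarrow> V t \<le> V s" and lb: "\<And>t. 0 \<le> t \<Longrightarrow> B \<le> V t"
  obtains l where "(V \<longlongrightarrow> l) at_top"
proof
  have bdd: "bdd_below (V ` {0..})" using lb by (intro bdd_belowI[of _ B]) auto
  show "(V \<longlongrightarrow> (INF t\<in>{0..}. V t)) at_top"
  proof (rule decreasing_tendsto)
    show "eventually (\<lambda>t. (INF t\<in>{0..}. V t) \<le> V t) at_top"
      using eventually_ge_at_top[of 0] by eventually_elim (auto intro!: cINF_lower bdd)
    fix x assume "(INF t\<in>{0..}. V t) < x"
    then obtain s where s: "s \<ge> 0" "V s < x"
      using cINF_less_iff[OF _ bdd] by auto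
    show "eventually (\<lambda>t. V t < x) at_top"
      using eventually_ge_at_top[of s] by eventually_elim (use s dec in \<open>blast intro: le_less_trans\<close>)
  qed
qed

text \<open>Heine-Cantor on \<open>K\<close>. It provides the uniform continuity that Barbalat's
  argument requires of quantities evaluated along a bounded trajectory.\<close>

lemma uniformly_continuous_on_compose_compact:
  fixes p :: "'a::metric_space \<Rightarrow> 'b::metric_space" and e :: "'b \<Rightarrow> 'c::metric_space"
  assumes p: "uniformly_continuous_on S p" "p ` S \<subseteq> K" and "compact K" "continuous_on K e"
  shows "uniformly_continuous_on S (\<lambda>t. e (p t))"
proof (rule uniformly_continuous_on_compose[OF p(1)])
  have "uniformly_continuous_on K e"
    using assms(3,4) by (intro compact_uniformly_continuous)
  with p(2) show "uniformly_continuous_on (p ` S) e"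
    unfolding uniformly_continuous_on_def by (meson subsetD)
qed

text \<open>The function \<open>V r + b * r\<close> has nonpositive derivative. At time 0 the
  derivative is only one-sided, so the sign is used on the open interval and continuity at its
  ends.\<close>

lemma vector_derivative_le_imp_linear_decrease:
  fixes V :: "real \<Rightarrow> real"
  assumes V: "\<And>t. t \<ge> 0 \<Longrightarrow> (V has_vector_derivative V' t) (at t within {0..})"
    and "0 \<le> s" "s \<le> t" and b: "\<And>r. s \<le> r \<Longrightarrow> r \<le> t \<Longrightarrow> V' r \<le> - b"
  shows "V t \<le> V s - b * (t - s)"
proof -
  have "(\<lambda>r. V r + b * r) t \<le> (\<lambda>r. V r + b * r) s"
  proof (rule DERIV_nonpos_imp_decreasing_open[OF \<open>s \<le> t\<close>])
    fix r assume "s < r" "r < t"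
    then have "at r within {0..} = at r"
      using \<open>0 \<le> s\<close> by (intro at_within_interior) auto
    then have "(V has_real_derivative V' r) (at r)"
      using V[of r] \<open>0 \<le> s\<close> \<open>s < r\<close>
      by (simp add: has_real_derivative_iff_has_vector_derivative)
    then have "((\<lambda>r. V r + b * r) has_real_derivative V' r + b) (at r)"
      by (auto intro!: derivative_eq_intros)
    moreover have "V' r + b \<le> 0" using b[of r] \<open>s < r\<close> \<open>r < t\<close> by simp
    ultimately show "\<exists>y. ((\<lambda>r. V r + b * r) has_real_derivative y) (at r) \<and> y \<le> 0" by blast
  next
    have "continuous_on {0..} V"
      unfolding continuous_on_eq_continuous_within
      using V by (auto intro: has_vector_derivative_continuous)
    then have "continuous_on {s..t} V"
      by (rule continuous_on_subset) (use \<open>0 \<le> s\<close> in auto)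
    then show "continuous_on {s..t} (\<lambda>r. V r + b * r)"
      by (intro continuous_intros)
  qed
  then show ?thesis by (simp add: algebra_simps)
qed

text \<open>Barbalat's argument: once \<^term>\<open>norm (e t)\<close> reaches a threshold, it stays above half of it
  for a fixed time, during which \<^term>\<open>V\<close> drops by a fixed amount.\<close>
lemma dissipation_tendsto_0:
  fixes e :: "real \<Rightarrow> 'a::real_normed_vector"
  assumes V: "\<And>t. t \<ge> 0 \<Longrightarrow> (V has_vector_derivative V' t) (at t within {0..})"
    and diss: "\<And>t. t \<ge> 0 \<Longrightarrow> V' t \<le> - c * (norm (e t))\<^sup>2" and "c > 0"
    and lb: "\<And>t. t \<ge> 0 \<Longrightarrow> B \<le> V t"
    and uc: "uniformly_continuous_on {0..} e"
  shows "(e \<longlongrightarrow> 0) at_top"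
proof -
  note drop = vector_derivative_le_imp_linear_decrease[OF V]
  have V'_le: "V' t \<le> - (c * x\<^sup>2)" if "t \<ge> 0" "x \<ge> 0" "x \<le> norm (e t)" for t x
  proof -
    have "c * x\<^sup>2 \<le> c * (norm (e t))\<^sup>2"
      using that \<open>c > 0\<close> by (intro mult_left_mono power_mono) auto
    with diss[of t] that show ?thesis by simp
  qed
  have "V t \<le> V s" if "0 \<le> s" "s \<le> t" for s t
    using drop[of s t 0] V'_le[of _ 0] that by simp
  then obtain l where l: "(V \<longlongrightarrow> l) at_top"
    using antimono_on_bounded_below_convergent[of V B] lb by blast
  show ?thesis
  proof (rule tendstoI)
    fix \<epsilon> :: real assume "\<epsilon> > 0"
    obtain \<delta> where "\<delta> > 0"
      and \<delta>: "\<And>t s. t \<in> {0..} \<Longrightarrow> s \<in> {0..} \<Longrightarrow> dist s t < \<delta> \<Longrightarrow> dist (e s) (e t) < \<epsilon> / 2"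
      by (rule uniformly_continuous_onE[OF uc half_gt_zero[OF \<open>\<epsilon> > 0\<close>]]) blast
    \<comment> \<open>Halving keeps the closed window \<open>{t..t + h}\<close> strictly inside the
      range of uniform continuity.\<close>
    define h where "h = \<delta> / 2"
    have "h > 0" "h < \<delta>" using \<open>\<delta> > 0\<close> by (auto simp: h_def)
    \<comment> \<open>As \<open>V\<close> converges, its drop over a window of fixed length tends to
      0; eventually this excludes the fixed drop that a large \<open>e t\<close> would
      cause.\<close>
    have "filterlim (\<lambda>t. t + h) at_top at_top"
      using filterlim_tendsto_add_at_top[OF tendsto_const filterlim_ident, of h] by (simp add: add.commute)
    then have "((\<lambda>t. V t - V (t + h)) \<longlongrightarrow> l - l) at_top"
      by (intro tendsto_diff l filterlim_compose[OF l])
    moreover have "c * (\<epsilon> / 2)\<^sup>2 * h > 0" using \<open>c > 0\<close> \<open>\<epsilon> > 0\<close> \<open>h > 0\<close> by simp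
    ultimately have "eventually (\<lambda>t. V t - V (t + h) < c * (\<epsilon> / 2)\<^sup>2 * h) at_top"
      by (auto dest: order_tendstoD)
    then show "eventually (\<lambda>t. dist (e t) 0 < \<epsilon>) at_top"
      using eventually_ge_at_top[of 0]
    proof eventually_elim
      case (elim t)
      show ?case
      proof (rule ccontr)
        assume "\<not> ?case"
        then have "norm (e t) \<ge> \<epsilon>" by simp
        have "V' r \<le> - (c * (\<epsilon> / 2)\<^sup>2)" if "t \<le> r" "r \<le> t + h" for r
        proof (rule V'_le)
          have "dist (e r) (e t) < \<epsilon> / 2"
            using \<delta>[of t r] that \<open>h < \<delta>\<close> \<open>0 \<le> t\<close> by (auto simp: dist_real_def)
          then show "\<epsilon> / 2 \<le> norm (e r)"
            using \<open>norm (e t) \<ge> \<epsilon>\<close> norm_triangle_sub[of "e t" "e r"]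
            by (simp add: dist_norm norm_minus_commute)
        qed (use that \<open>0 \<le> t\<close> \<open>\<epsilon> > 0\<close> in auto)
        then have "V (t + h) \<le> V t - c * (\<epsilon> / 2)\<^sup>2 * h"
          using drop[of t "t + h" "c * (\<epsilon> / 2)\<^sup>2"] \<open>0 \<le> t\<close> \<open>h > 0\<close> by simp
        with elim show False by simp
      qed
    qed
  qed
qed

lemma vector_derivative_tendsto_0_imp_slow:
  fixes y :: "real \<Rightarrow> 'a::real_normed_vector"
  assumes y: "\<And>t. t \<ge> 0 \<Longrightarrow> (y has_vector_derivative y' t) (at t within {0..})"
    and lim: "(y' \<longlongrightarrow> 0) at_top" and "h > 0" "\<epsilon> > 0"
  shows "eventually (\<lambda>t. \<forall>s\<in>{t..t + h}. norm (y s - y t) \<le> \<epsilon>) at_top"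
proof -
  \<comment> \<open>The displacement is bounded by \<open>norm (s - t)\<close> times
    \<open>3 * b\<close>: \<open>b\<close> for the velocity at \<open>t\<close> and
    \<open>2 * b\<close> for its variation.\<close>
  define b where "b = \<epsilon> / (3 * h)"
  have "b > 0" using assms(3,4) by (simp add: b_def)
  then have "eventually (\<lambda>t. norm (y' t) < b) at_top"
    using tendstoD[OF lim] by simp
  then have "eventually (\<lambda>t. \<forall>s\<ge>t. norm (y' s) < b) at_top"
    by (rule eventually_all_ge_at_top)
  then show ?thesis
    using eventually_ge_at_top[of 0]
  proof eventually_elim
    case (elim t)
    show ?case
    proof
      fix s assume s: "s \<in> {t..t + h}"
      have "norm (y s - y t - (s - t) *\<^sub>R y' t) \<le> norm (s - t) * (2 * b)"
      proof (rule vector_differentiable_bound_linearization)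
        show "(y has_vector_derivative y' r) (at r within {t..s})" if "r \<in> {t..s}" for r
          using y[of r] that elim by (auto intro: has_vector_derivative_within_subset)
        show "norm (y' r - y' t) \<le> 2 * b" if "r \<in> {t..s}" for r
          using elim(1) that norm_triangle_ineq4[of "y' r" "y' t"] by (smt (verit) atLeastAtMost_iff)
      qed (use s in \<open>auto simp: closed_segment_eq_real_ivl\<close>)
      moreover have "norm (y s - y t) \<le> norm (y s - y t - (s - t) *\<^sub>R y' t) + norm ((s - t) *\<^sub>R y' t)"
        using norm_triangle_ineq[of "y s - y t - (s - t) *\<^sub>R y' t" "(s - t) *\<^sub>R y' t"] by simp
      moreover have "norm ((s - t) *\<^sub>R y' t) \<le> norm (s - t) * b"
        using elim(1) by (simp add: mult_left_mono less_imp_le)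
      ultimately have "norm (y s - y t) \<le> norm (s - t) * (3 * b)" by simp
      also have "\<dots> \<le> h * (3 * b)"
        using s \<open>b > 0\<close> by (intro mult_right_mono) auto
      also have "\<dots> = \<epsilon>" using \<open>h > 0\<close> by (simp add: b_def)
      finally show "norm (y s - y t) \<le> \<epsilon>" .
    qed
  qed
qed

text \<open>If the velocity is almost constant over a window of length \<^term>\<open>h\<close>, the displacement over
  the window is almost \<^term>\<open>h\<close> times the velocity. It stays bounded, so the velocity is small
  once \<^term>\<open>h\<close> is large.\<close>
lemma bounded_imp_slowly_varying_derivative_tendsto_0:
  fixes x :: "real \<Rightarrow> 'a::real_normed_vector"
  assumes x: "\<And>t. t \<ge> 0 \<Longrightarrow> (x has_vector_derivative x' t) (at t within {0..})"
    and bound: "\<And>t. t \<ge> 0 \<Longrightarrow> norm (x t) \<le> R"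
    and slow: "\<And>h \<epsilon>. h > 0 \<Longrightarrow> \<epsilon> > 0 \<Longrightarrow>
      eventually (\<lambda>t. \<forall>s\<in>{t..t + h}. norm (z s - z t) \<le> \<epsilon>) at_top"
    and lim: "((\<lambda>t. x' t - z t) \<longlongrightarrow> 0) at_top"
  shows "(x' \<longlongrightarrow> 0) at_top"
proof (rule tendstoI)
  fix \<epsilon> :: real assume "\<epsilon> > 0"
  have "R \<ge> 0" using bound[of 0] norm_ge_zero[of "x 0"] by linarith
  \<comment> \<open>The displacement is at most \<open>2 * R\<close>, and this \<open>h\<close>
    makes \<open>h * \<epsilon> / 2\<close> equal to \<open>2 * (R + 1)\<close>, strictly larger.
    The velocity varies by at most \<open>\<epsilon> / 2\<close> over the window, the sum of
    \<open>\<epsilon> / 8\<close>, \<open>\<epsilon> / 4\<close> and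
    \<open>\<epsilon> / 8\<close>.\<close>
  define h where "h = 4 * (R + 1) / \<epsilon>"
  have "h > 0" using \<open>R \<ge> 0\<close> \<open>\<epsilon> > 0\<close> by (simp add: h_def)
  have "eventually (\<lambda>t. norm (x' t - z t) < \<epsilon> / 8) at_top"
    using tendstoD[OF lim, of "\<epsilon> / 8"] \<open>\<epsilon> > 0\<close> by simp
  then have "eventually (\<lambda>t. \<forall>s\<ge>t. norm (x' s - z s) < \<epsilon> / 8) at_top"
    by (rule eventually_all_ge_at_top)
  moreover have "eventually (\<lambda>t. \<forall>s\<in>{t..t + h}. norm (z s - z t) \<le> \<epsilon> / 4) at_top"
    using slow[of h "\<epsilon> / 4"] \<open>h > 0\<close> \<open>\<epsilon> > 0\<close> by simp
  ultimately show "eventually (\<lambda>t. dist (x' t) 0 < \<epsilon>) at_top"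
    using eventually_ge_at_top[of 0]
  proof eventually_elim
    case (elim t)
    have "norm (x (t + h) - x t - (t + h - t) *\<^sub>R x' t) \<le> norm (t + h - t) * (\<epsilon> / 2)"
    proof (rule vector_differentiable_bound_linearization)
      show "(x has_vector_derivative x' s) (at s within {t..t + h})" if "s \<in> {t..t + h}" for s
        using x[of s] that elim by (auto intro: has_vector_derivative_within_subset)
      show "norm (x' s - x' t) \<le> \<epsilon> / 2" if "s \<in> {t..t + h}" for s
      proof -
        have "x' s - x' t = (x' s - z s) + (z s - z t) - (x' t - z t)" by simp
        then have "norm (x' s - x' t) \<le> norm (x' s - z s) + norm (z s - z t) + norm (x' t - z t)"
          by (metis add_right_mono norm_triangle_ineq norm_triangle_ineq4 order_trans)
        moreover have "norm (x' s - z s) < \<epsilon> / 8" "norm (x' t - z t) < \<epsilon> / 8" "norm (z s - z t) \<le> \<epsilon> / 4"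
          using elim that by auto
        ultimately show ?thesis by linarith
      qed
    qed (use elim \<open>h > 0\<close> in \<open>auto simp: closed_segment_eq_real_ivl\<close>)
    then have "norm (x (t + h) - x t - h *\<^sub>R x' t) \<le> h * (\<epsilon> / 2)"
      using \<open>h > 0\<close> by simp
    moreover have "norm (h *\<^sub>R x' t) \<le> norm (x (t + h)) + norm (x t) + norm (x (t + h) - x t - h *\<^sub>R x' t)"
      using norm_triangle_ineq4[of "x (t + h) - x t" "x (t + h) - x t - h *\<^sub>R x' t"]
        norm_triangle_ineq4[of "x (t + h)" "x t"] by simp
    moreover have "norm (x (t + h)) \<le> R" "norm (x t) \<le> R"
      using bound elim \<open>h > 0\<close> by auto
    ultimately have "h * norm (x' t) \<le> 2 * R + h * (\<epsilon> / 2)"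
      using \<open>h > 0\<close> by simp
    also have "\<dots> < h * \<epsilon>"
      using \<open>\<epsilon> > 0\<close> \<open>R \<ge> 0\<close> by (simp add: h_def field_simps)
    finally show ?case using \<open>h > 0\<close> by simp
  qed
qed

text \<open>The part of \<open>closure K\<close> at distance at least \<open>\<epsilon>\<close> from
  the zeros is compact and \<open>F\<close> does not vanish there, so \<open>norm (F w)\<close> has
  a positive lower bound \<open>m\<close> on it. Once \<open>F (p t)\<close> is below
  \<open>m\<close>, the trajectory has left that part.\<close>

lemma infdist_zeros_tendsto_0:
  fixes F :: "'a::heine_borel \<Rightarrow> 'b::real_normed_vector" and p :: "real \<Rightarrow> 'a"
  assumes F: "continuous_on UNIV F" and K: "bounded K" "\<And>t. t \<ge> 0 \<Longrightarrow> p t \<in> K"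
    and lim: "((\<lambda>t. F (p t)) \<longlongrightarrow> 0) at_top"
  shows "((\<lambda>t. infdist (p t) {w. F w = 0}) \<longlongrightarrow> 0) at_top"
proof (rule tendstoI)
  fix \<epsilon> :: real assume "\<epsilon> > 0"
  define C where "C = closure K \<inter> {w. \<epsilon> \<le> infdist w {w. F w = 0}}"
  have "compact C"
    unfolding C_def using K(1)
    by (intro compact_Int_closed closed_Collect_le continuous_intros) (auto simp: compact_closure)
  have pos: "norm (F w) > 0" if "w \<in> C" for w
    using that \<open>\<epsilon> > 0\<close> by (auto simp: C_def)
  have "\<exists>m>0. \<forall>w\<in>C. m \<le> norm (F w)"
  proof (cases "C = {}")
    case False
    have "continuous_on C (\<lambda>w. norm (F w))"
      by (intro continuous_intros continuous_on_subset[OF F]) auto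
    then obtain u where "u \<in> C" "\<forall>w\<in>C. norm (F u) \<le> norm (F w)"
      using continuous_attains_inf[OF \<open>compact C\<close> False] by blast
    then show ?thesis using pos by blast
  qed (auto intro: exI[of _ 1])
  then obtain m where "m > 0" and m: "\<And>w. w \<in> C \<Longrightarrow> m \<le> norm (F w)" by blast
  have "eventually (\<lambda>t. dist (F (p t)) 0 < m) at_top"
    using lim \<open>m > 0\<close> by (rule tendstoD)
  then show "eventually (\<lambda>t. dist (infdist (p t) {w. F w = 0}) 0 < \<epsilon>) at_top"
    using eventually_ge_at_top[of 0]
  proof eventually_elim
    case (elim t)
    then have "p t \<notin> C" using m[of "p t"] by auto
    then show ?case
      using K(2)[OF \<open>0 \<le> t\<close>] closure_subset[of K] by (auto simp: C_def infdist_nonneg)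
  qed
qed

section \<open>The proximal gradient flow\<close>

locale proximal_flow =
  fixes f :: "real^'n \<Rightarrow> real" and g :: "real^'m \<Rightarrow> ereal"
    and T :: "real^'n^'m" and \<mu> :: real
  assumes mu: "\<mu> > 0"
    and f_C1: "continuously_differentiable f"
    and f_convex: "convex_on UNIV f"
    and f_lipschitz: "\<exists>L. L-lipschitz_on UNIV (gradient f)"
    and g: "proper g" "lower_semicontinuous g" "ereal_convex g"
    and optimal_pair_exists: "optimal_pairs f g T \<noteq> {}"
begin

section \<open>Equilibria and continuity of the field\<close>

text \<open>This is the gradient \<open>d\<close> inside \<open>flow_field\<close>; the
  \<open>y\<close> component of the flow drives \<open>y\<close> towards it.\<close>

definition dual :: "(real^'n) \<times> (real^'m) \<Rightarrow> real^'m" where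
  "dual w = gradient (moreau_envelope \<mu> g) (T *v fst w + \<mu> *\<^sub>R snd w)"

lemma flow_field_eq:
  "flow_field \<mu> f g T w =
     (- (gradient f (fst w) + transpose T *v dual w), \<mu> *\<^sub>R (dual w - snd w))"
  by (simp add: flow_field_def dual_def case_prod_beta Let_def)

lemma optimal_pairs_iff:
  "w \<in> optimal_pairs f g T \<longleftrightarrow>
     gradient f (fst w) + transpose T *v snd w = 0 \<and> snd w \<in> subdifferential g (T *v fst w)"
  by (cases w) (auto simp: optimal_pairs_def)

text \<open>An optimal pair supplies the subgradient that the results on \<open>prox\<close>
  assume.\<close>

lemma subdifferential_nonempty: "\<exists>s z. s \<in> subdifferential g z"
  using optimal_pair_exists optimal_pairs_iff by blast

lemma dual_eq:
  "dual w = (1 / \<mu>) *\<^sub>R ((T *v fst w + \<mu> *\<^sub>R snd w) - prox \<mu> g (T *v fst w + \<mu> *\<^sub>R snd w))"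
  unfolding dual_def using gradient_moreau_envelope[OF mu g] subdifferential_nonempty by blast

text \<open>The point is the proximal point in disguise: \<open>\<mu> *\<^sub>R dual w\<close> is
  the proximal residual at \<open>T x + \<mu> y\<close>. In this form monotonicity can be applied
  against an optimal pair.\<close>

lemma dual_subdifferential:
  "dual w \<in> subdifferential g (T *v fst w - \<mu> *\<^sub>R (dual w - snd w))"
proof -
  let ?v = "T *v fst w + \<mu> *\<^sub>R snd w"
  have "dual w \<in> subdifferential g (prox \<mu> g ?v)"
    unfolding dual_eq using prox_subdifferential[OF mu g] subdifferential_nonempty by blast
  moreover have "prox \<mu> g ?v = T *v fst w - \<mu> *\<^sub>R (dual w - snd w)"
    using mu by (simp add: dual_eq algebra_simps)
  ultimately show ?thesis by simp
qed

lemma continuous_on_dual: "continuous_on A dual"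
proof -
  define P where "P v = (1 / \<mu>) *\<^sub>R (v - prox \<mu> g v)" for v
  have "norm (P w - P v) \<le> norm (w - v) / \<mu>" for v w
    unfolding P_def using prox_residual_lipschitz[OF mu g] subdifferential_nonempty by blast
  then have "(1 / \<mu>)-lipschitz_on UNIV P"
    using mu by (intro lipschitz_onI) (auto simp: dist_norm)
  then have "continuous_on UNIV P" by (rule lipschitz_on_continuous_on)
  moreover have "continuous_on A (\<lambda>w. T *v fst w + \<mu> *\<^sub>R snd w)"
    by (intro continuous_intros bounded_linear.continuous_on[OF matrix_vector_mul_bounded_linear])
  ultimately have "continuous_on A (\<lambda>w. P (T *v fst w + \<mu> *\<^sub>R snd w))"
    by (rule continuous_on_compose2) auto
  then show ?thesis by (simp add: P_def dual_eq[abs_def])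
qed

lemma continuous_on_gradient: "continuous_on A (\<lambda>w. gradient f (fst w))"
proof -
  have "continuous_on UNIV (gradient f)"
    using f_C1 by (simp add: continuously_differentiable_def)
  then show ?thesis by (rule continuous_on_compose2) (auto intro: continuous_intros)
qed

lemma continuous_on_flow_field: "continuous_on A (flow_field \<mu> f g T)"
  unfolding flow_field_eq[abs_def]
  by (intro continuous_intros continuous_on_gradient continuous_on_dual
      bounded_linear.continuous_on[OF matrix_vector_mul_bounded_linear])

text \<open>At a zero, \<open>dual w\<close> equals \<open>snd w\<close>, so
  \<open>dual_subdifferential\<close> becomes the optimality condition for \<open>g\<close>.
  Conversely, that condition identifies the proximal point as \<open>T *v fst w\<close>, whence
  \<open>dual w = snd w\<close>.\<close>

lemma flow_field_eq_0_iff: "flow_field \<mu> f g T w = 0 \<longleftrightarrow> w \<in> optimal_pairs f g T"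
proof
  assume "flow_field \<mu> f g T w = 0"
  then have "dual w = snd w" "gradient f (fst w) + transpose T *v dual w = 0"
    using mu by (auto simp: flow_field_eq zero_prod_def neg_eq_iff_add_eq_0)
  then show "w \<in> optimal_pairs f g T"
    using dual_subdifferential[of w] by (simp add: optimal_pairs_iff)
next
  assume w: "w \<in> optimal_pairs f g T"
  then have "prox \<mu> g (T *v fst w + \<mu> *\<^sub>R snd w) = T *v fst w"
    by (intro prox_eqI mu g) (auto simp: optimal_pairs_iff)
  then have "dual w = snd w" using mu by (simp add: dual_eq)
  with w show "flow_field \<mu> f g T w = 0"
    by (simp add: flow_field_eq optimal_pairs_iff zero_prod_def)
qed

section \<open>Dissipation and Lyapunov stability\<close>

lemma flow_field_dissipation:
  assumes ws: "ws \<in> optimal_pairs f g T"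
  shows "(w - ws) \<bullet> flow_field \<mu> f g T w
    \<le> - ((gradient f (fst w) - gradient f (fst ws)) \<bullet> (fst w - fst ws)) - \<mu> * (norm (dual w - snd w))\<^sup>2"
proof -
  define G where "G = gradient f (fst w) - gradient f (fst ws)"
  define x where "x = fst w - fst ws"
  define y where "y = snd w - snd ws"
  define d where "d = dual w - snd ws"
  have opt: "gradient f (fst ws) + transpose T *v snd ws = 0" "snd ws \<in> subdifferential g (T *v fst ws)"
    using ws by (auto simp: optimal_pairs_iff)
  \<comment> \<open>Subtracting the stationarity condition at \<open>ws\<close>, which is zero,
    expresses everything through differences.\<close>
  have "gradient f (fst w) + transpose T *v dual w
      = gradient f (fst w) + transpose T *v dual w - (gradient f (fst ws) + transpose T *v snd ws)"
    by (simp only: opt(1) diff_0_right)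
  also have "\<dots> = G + transpose T *v d"
    by (simp add: G_def d_def matrix_vector_mult_diff_distrib)
  finally have "(w - ws) \<bullet> flow_field \<mu> f g T w
      = - (G \<bullet> x) - (transpose T *v d) \<bullet> x + \<mu> * (y \<bullet> (d - y))"
    unfolding flow_field_eq
    by (simp add: inner_prod_def x_def y_def d_def inner_add_right inner_diff_right inner_commute)
  also have "(transpose T *v d) \<bullet> x = d \<bullet> (T *v x)"
    by (metis dot_lmul_matrix transpose_matrix_vector)
  \<comment> \<open>Writing \<open>y\<close> as \<open>d - (d - y)\<close> splits off the square;
    the remaining inner product pairs a difference of subgradients of \<open>g\<close> with the
    difference of their base points.\<close>
  also have "- (G \<bullet> x) - d \<bullet> (T *v x) + \<mu> * (y \<bullet> (d - y))
      = - (G \<bullet> x) - \<mu> * (norm (d - y))\<^sup>2 - d \<bullet> (T *v x - \<mu> *\<^sub>R (d - y))"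
    by (simp add: power2_norm_eq_inner inner_diff_left inner_diff_right inner_commute algebra_simps)
  also have "d \<bullet> (T *v x - \<mu> *\<^sub>R (d - y)) \<ge> 0"
    using subdifferential_monotone[OF g(1) dual_subdifferential[of w] opt(2)]
    by (simp add: d_def x_def y_def matrix_vector_mult_diff_distrib algebra_simps)
  then have "- (G \<bullet> x) - \<mu> * (norm (d - y))\<^sup>2 - d \<bullet> (T *v x - \<mu> *\<^sub>R (d - y))
      \<le> - (G \<bullet> x) - \<mu> * (norm (d - y))\<^sup>2" by simp
  finally show ?thesis by (simp add: G_def x_def y_def d_def)
qed

lemma gradient_f_cocoercive:
  obtains L where "L > 0"
    "\<And>x y. (norm (gradient f x - gradient f y))\<^sup>2 \<le> L * ((gradient f x - gradient f y) \<bullet> (x - y))"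
proof -
  obtain L where "L-lipschitz_on UNIV (gradient f)" using f_lipschitz by blast
  \<comment> \<open>The given constant may be 0, while cocoercivity is stated for a positive
    one.\<close>
  then have "(max L 1)-lipschitz_on UNIV (gradient f)"
    by (rule lipschitz_on_le) simp
  from gradient_cocoercive[OF f_convex continuously_differentiable_GDERIV[OF f_C1] this]
  show ?thesis by (intro that[of "4 * max L 1"]) auto
qed

lemma trajectory_square_distance_derivative:
  fixes ws :: "(real^'n) \<times> (real^'m)"
  assumes "trajectory F p" "t \<ge> 0"
  shows "((\<lambda>t. (norm (p t - ws))\<^sup>2) has_vector_derivative 2 * ((p t - ws) \<bullet> F (p t))) (at t within {0..})"
proof -
  have "(p has_vector_derivative F (p t)) (at t within {0..})"
    using assms by (auto simp: trajectory_def)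
  then have "((\<lambda>t. p t - ws) has_vector_derivative F (p t)) (at t within {0..})"
    by (auto intro!: derivative_eq_intros)
  from bounded_bilinear.has_vector_derivative[OF bounded_bilinear_inner this this]
  show ?thesis by (simp add: power2_norm_eq_inner inner_commute)
qed

text \<open>Fejer monotonicity: cocoercivity makes \<open>gradient f\<close> monotone, so both terms
  of the dissipation bound are nonpositive.\<close>

lemma trajectory_norm_le:
  assumes p: "trajectory (flow_field \<mu> f g T) p" and ws: "ws \<in> optimal_pairs f g T" and "t \<ge> 0"
  shows "norm (p t - ws) \<le> norm (p 0 - ws)"
proof -
  obtain L where "L > 0" and
    L: "\<And>x y. (norm (gradient f x - gradient f y))\<^sup>2 \<le> L * ((gradient f x - gradient f y) \<bullet> (x - y))"
    using gradient_f_cocoercive by blast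
  have mono: "(gradient f x - gradient f y) \<bullet> (x - y) \<ge> 0" for x y
    using order_trans[OF zero_le_power2 L] \<open>L > 0\<close> by (simp add: zero_le_mult_iff)
  have "(norm (p t - ws))\<^sup>2 \<le> (norm (p 0 - ws))\<^sup>2 - 0 * (t - 0)"
  proof (rule vector_derivative_le_imp_linear_decrease[OF trajectory_square_distance_derivative[OF p]])
    fix r :: real
    have "(p r - ws) \<bullet> flow_field \<mu> f g T (p r) \<le> 0"
      using flow_field_dissipation[OF ws, of "p r"] mono[of "fst (p r)" "fst ws"] mu
      by (smt (verit) mult_nonneg_nonneg zero_le_power2)
    then show "2 * ((p r - ws) \<bullet> flow_field \<mu> f g T (p r)) \<le> - 0" by simp
  qed (use \<open>t \<ge> 0\<close> in auto)
  then show ?thesis by (intro power2_le_imp_le[OF _ norm_ge_zero]) simp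
qed

text \<open>The distance to each optimal pair never exceeds its initial value; taking the infimum
  over all pairs, \<open>\<delta> = \<epsilon>\<close> suffices.\<close>

lemma flow_lyapunov_stable: "lyapunov_stable (flow_field \<mu> f g T) (optimal_pairs f g T)"
proof -
  have "infdist (p t) (optimal_pairs f g T) \<le> infdist (p 0) (optimal_pairs f g T)"
    if "trajectory (flow_field \<mu> f g T) p" "t \<ge> 0" for p t
  proof -
    have "infdist (p t) (optimal_pairs f g T) \<le> dist (p 0) ws" if "ws \<in> optimal_pairs f g T" for ws
      using infdist_le[OF that, of "p t"] trajectory_norm_le[OF \<open>trajectory _ p\<close> that \<open>t \<ge> 0\<close>]
      by (simp add: dist_norm)
    then show ?thesis
      using optimal_pair_exists by (subst infdist_notempty[of _ "p 0"]) (auto intro!: cINF_greatest)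
  qed
  then show ?thesis unfolding lyapunov_stable_def by (meson le_less_trans)
qed

section \<open>Convergence of trajectories\<close>

lemma trajectory_flow_field_tendsto_0:
  assumes p: "trajectory (flow_field \<mu> f g T) p"
  shows "((\<lambda>t. flow_field \<mu> f g T (p t)) \<longlongrightarrow> 0) at_top"
proof -
  obtain ws where ws: "ws \<in> optimal_pairs f g T" using optimal_pair_exists by blast
  obtain L where "L > 0" and
    L: "\<And>x y. (norm (gradient f x - gradient f y))\<^sup>2 \<le> L * ((gradient f x - gradient f y) \<bullet> (x - y))"
    using gradient_f_cocoercive by blast
  have deriv: "(p has_vector_derivative flow_field \<mu> f g T (p t)) (at t within {0..})" if "t \<ge> 0" for t
    using p that by (auto simp: trajectory_def)
  define K where "K = cball ws (norm (p 0 - ws))"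
  have "compact K" by (simp add: K_def)
  have pK: "p t \<in> K" if "t \<ge> 0" for t
    using trajectory_norm_le[OF p ws that] by (simp add: K_def dist_norm norm_minus_commute)
  obtain R where R: "\<And>w. w \<in> K \<Longrightarrow> norm w \<le> R"
    using compact_imp_bounded[OF \<open>compact K\<close>] by (auto simp: bounded_iff)
  \<comment> \<open>The field is bounded on the compact ball \<open>K\<close>, so the trajectory is
    Lipschitz in time.\<close>
  have uc_p: "uniformly_continuous_on {0..} p"
  proof -
    obtain M where M: "\<And>w. w \<in> K \<Longrightarrow> norm (flow_field \<mu> f g T w) \<le> M"
      using compact_imp_bounded[OF compact_continuous_image[OF continuous_on_flow_field \<open>compact K\<close>]]
      by (auto simp: bounded_iff)
    have "norm (p s - p t) \<le> M * norm (s - t)" if "s \<ge> 0" "t \<ge> 0" for s t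
    proof (rule differentiable_bound)
      show "(p has_derivative (\<lambda>h. h *\<^sub>R flow_field \<mu> f g T (p r))) (at r within {0..})"
        if "r \<in> {0..}" for r
        using deriv[of r] that by (simp add: has_vector_derivative_def)
      show "onorm (\<lambda>h. h *\<^sub>R flow_field \<mu> f g T (p r)) \<le> M" if "r \<in> {0..}" for r
        using M[OF pK[of r]] that
        by (intro onorm_le) (simp add: mult.commute[of M] mult_left_mono)
    qed (use that in auto)
    moreover have "M \<ge> 0" using M[OF pK[of 0]] norm_ge_zero by (meson order_trans order_refl)
    ultimately have "M-lipschitz_on {0..} p" by (intro lipschitz_onI) (auto simp: dist_norm)
    then show ?thesis by (rule lipschitz_on_uniformly_continuous)
  qed
  note uc = uniformly_continuous_on_compose_compact[OF uc_p _ \<open>compact K\<close>]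
  note V = trajectory_square_distance_derivative[OF p, of _ ws]
  have grad: "((\<lambda>t. gradient f (fst (p t)) - gradient f (fst ws)) \<longlongrightarrow> 0) at_top"
  proof (rule dissipation_tendsto_0[OF V, where B = 0 and c = "2 / L"])
    fix t :: real
    let ?G = "gradient f (fst (p t)) - gradient f (fst ws)"
    have "(norm ?G)\<^sup>2 / L \<le> ?G \<bullet> (fst (p t) - fst ws)"
      using L[of "fst (p t)" "fst ws"] \<open>L > 0\<close> by (simp add: field_simps)
    moreover have "\<mu> * (norm (dual (p t) - snd (p t)))\<^sup>2 \<ge> 0" using mu by simp
    ultimately have "(p t - ws) \<bullet> flow_field \<mu> f g T (p t) \<le> - ((norm ?G)\<^sup>2 / L)"
      using flow_field_dissipation[OF ws, of "p t"] by linarith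
    then show "2 * ((p t - ws) \<bullet> flow_field \<mu> f g T (p t)) \<le> - (2 / L) * (norm ?G)\<^sup>2" by simp
    show "0 \<le> (norm (p t - ws))\<^sup>2" by simp
    show "uniformly_continuous_on {0..} (\<lambda>t. gradient f (fst (p t)) - gradient f (fst ws))"
      by (rule uc[where e = "\<lambda>w. gradient f (fst w) - gradient f (fst ws)"])
        (use pK in \<open>auto intro!: continuous_on_diff continuous_on_gradient\<close>)
  qed (use \<open>L > 0\<close> in auto)
  have gap: "((\<lambda>t. dual (p t) - snd (p t)) \<longlongrightarrow> 0) at_top"
  proof (rule dissipation_tendsto_0[OF V, where B = 0 and c = "2 * \<mu>"])
    fix t :: real
    let ?G = "gradient f (fst (p t)) - gradient f (fst ws)"
    have "L * (?G \<bullet> (fst (p t) - fst ws)) \<ge> 0"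
      using order_trans[OF zero_le_power2 L] .
    then have "?G \<bullet> (fst (p t) - fst ws) \<ge> 0" using \<open>L > 0\<close> by (simp add: zero_le_mult_iff)
    then show "2 * ((p t - ws) \<bullet> flow_field \<mu> f g T (p t)) \<le> - (2 * \<mu>) * (norm (dual (p t) - snd (p t)))\<^sup>2"
      using flow_field_dissipation[OF ws, of "p t"] by simp
    show "0 \<le> (norm (p t - ws))\<^sup>2" by simp
    show "uniformly_continuous_on {0..} (\<lambda>t. dual (p t) - snd (p t))"
      by (rule uc[where e = "\<lambda>w. dual w - snd w"])
        (use pK in \<open>auto intro!: continuous_on_diff continuous_on_dual continuous_on_snd\<close>)
  qed (use mu in auto)
  \<comment> \<open>This is the velocity of \<open>x\<close> with the gradient of \<open>f\<close>
    replaced by its optimal value and \<open>dual\<close> by \<open>y\<close>. By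
    \<open>grad\<close> and \<open>gap\<close> the error vanishes, and \<open>z\<close> varies
    slowly because the velocity of \<open>y\<close> tends to 0.\<close>
  define z where "z t = - (gradient f (fst ws) + transpose T *v snd (p t))" for t
  note bl = matrix_vector_mul_bounded_linear[of "transpose T"]
  have dy: "((\<lambda>t. snd (p t)) has_vector_derivative \<mu> *\<^sub>R (dual (p t) - snd (p t))) (at t within {0..})"
    if "t \<ge> 0" for t
    using bounded_linear.has_vector_derivative[OF bounded_linear_snd deriv[OF that]] by (simp add: flow_field_eq)
  have dx: "((\<lambda>t. fst (p t)) has_vector_derivative fst (flow_field \<mu> f g T (p t))) (at t within {0..})"
    if "t \<ge> 0" for t
    using bounded_linear.has_vector_derivative[OF bounded_linear_fst deriv[OF that]] .
  have dz: "(z has_vector_derivative - (transpose T *v (\<mu> *\<^sub>R (dual (p t) - snd (p t))))) (at t within {0..})"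
    if "t \<ge> 0" for t
    unfolding z_def using bounded_linear.has_vector_derivative[OF bl dy[OF that]]
    by (auto intro!: derivative_eq_intros)
  have "((\<lambda>t. - (transpose T *v (\<mu> *\<^sub>R (dual (p t) - snd (p t))))) \<longlongrightarrow> - (transpose T *v (\<mu> *\<^sub>R 0))) at_top"
    by (intro tendsto_intros bounded_linear.tendsto[OF bl] gap)
  then have slow: "eventually (\<lambda>t. \<forall>s\<in>{t..t + h}. norm (z s - z t) \<le> \<epsilon>) at_top" if "h > 0" "\<epsilon> > 0" for h \<epsilon>
    using vector_derivative_tendsto_0_imp_slow[OF dz _ that] by simp
  have "((\<lambda>t. fst (flow_field \<mu> f g T (p t))) \<longlongrightarrow> 0) at_top"
  proof (rule bounded_imp_slowly_varying_derivative_tendsto_0[OF dx _ slow])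
    show "norm (fst (p t)) \<le> R" if "t \<ge> 0" for t
      using R[OF pK[OF that]] norm_fst_le[of "fst (p t)" "snd (p t)"] by simp
    have "((\<lambda>t. - (gradient f (fst (p t)) - gradient f (fst ws)) - transpose T *v (dual (p t) - snd (p t)))
        \<longlongrightarrow> - 0 - transpose T *v 0) at_top"
      by (intro tendsto_intros bounded_linear.tendsto[OF bl] gap grad)
    then show "((\<lambda>t. fst (flow_field \<mu> f g T (p t)) - z t) \<longlongrightarrow> 0) at_top"
      by (simp add: flow_field_eq z_def matrix_vector_mult_diff_distrib algebra_simps)
  qed
  moreover have "((\<lambda>t. \<mu> *\<^sub>R (dual (p t) - snd (p t))) \<longlongrightarrow> \<mu> *\<^sub>R 0) at_top"
    by (intro tendsto_intros gap)
  ultimately have "((\<lambda>t. (fst (flow_field \<mu> f g T (p t)), \<mu> *\<^sub>R (dual (p t) - snd (p t)))) \<longlongrightarrow> (0, \<mu> *\<^sub>R 0)) at_top"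
    by (rule tendsto_Pair)
  then show ?thesis by (simp add: flow_field_eq zero_prod_def)
qed

lemma flow_globally_asymptotically_stable:
  "globally_asymptotically_stable (flow_field \<mu> f g T) (optimal_pairs f g T)"
proof -
  obtain ws where ws: "ws \<in> optimal_pairs f g T" using optimal_pair_exists by blast
  have "((\<lambda>t. infdist (p t) {w. flow_field \<mu> f g T w = 0}) \<longlongrightarrow> 0) at_top"
    if p: "trajectory (flow_field \<mu> f g T) p" for p
    using trajectory_norm_le[OF p ws]
    by (intro infdist_zeros_tendsto_0[OF continuous_on_flow_field, of "cball ws (norm (p 0 - ws))"]
        trajectory_flow_field_tendsto_0[OF p]) (auto simp: dist_norm norm_minus_commute)
  then show ?thesis
    using optimal_pair_exists flow_lyapunov_stable
    by (simp add: globally_asymptotically_stable_def flow_field_eq_0_iff)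
qed

section \<open>Optimality for the composite problem\<close>

text \<open>The tangent inequality for \<open>f\<close> and the subgradient inequality for
  \<open>g\<close> are added; stationarity makes their linear terms cancel after \<open>T\<close> is
  moved across the inner product.\<close>

lemma optimal_pair_minimizer:
  assumes "w \<in> optimal_pairs f g T"
  shows "is_arg_min (\<lambda>x. ereal (f x) + g (T *v x)) (\<lambda>_. True) (fst w)"
proof -
  have opt: "gradient f (fst w) + transpose T *v snd w = 0" "snd w \<in> subdifferential g (T *v fst w)"
    using assms by (auto simp: optimal_pairs_iff)
  obtain b where b: "g (T *v fst w) = ereal b"
    using subdifferential_finite[OF g(1) opt(2)] by auto
  have "ereal (f (fst w)) + g (T *v fst w) \<le> ereal (f x) + g (T *v x)" for x
  proof -
    have "f (fst w) + gradient f (fst w) \<bullet> (x - fst w) \<le> f x"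
      by (intro convex_on_above_tangent_gradient f_convex continuously_differentiable_GDERIV f_C1)
    moreover have "ereal (b + snd w \<bullet> (T *v x - T *v fst w)) \<le> g (T *v x)"
      using subdifferentialD[OF opt(2), of "T *v x"] by (simp add: b)
    moreover have "snd w \<bullet> (T *v x - T *v fst w) = (transpose T *v snd w) \<bullet> (x - fst w)"
      by (metis dot_lmul_matrix transpose_matrix_vector matrix_vector_mult_diff_distrib)
    moreover have "(transpose T *v snd w) \<bullet> (x - fst w) = - (gradient f (fst w) \<bullet> (x - fst w))"
      using opt(1) by (metis add_eq_0_iff inner_minus_left)
    ultimately show ?thesis by (cases "g (T *v x)") (auto simp: b)
  qed
  then show ?thesis by (simp add: is_arg_min_linorder)
qed

end

theorem theorem2:
  fixes f :: "real^'n \<Rightarrow> real" and g :: "real^'m \<Rightarrow> ereal"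
    and T :: "real^'n^'m" and \<mu> :: real
  assumes mu: "\<mu> > 0"
    and f_C1: "continuously_differentiable f"
    and f_convex: "convex_on UNIV f"
    and f_lipschitz: "\<exists>L. L-lipschitz_on UNIV (gradient f)"
    and g_proper: "proper g"
    and g_lsc: "lower_semicontinuous g"
    and g_convex: "ereal_convex g"
    and feasible: "\<exists>x. g (T *v x) < \<infinity>"
    and finite_minimum: "\<bar>INF x. ereal (f x) + g (T *v x)\<bar> \<noteq> \<infinity>"
    and optimal_pair_exists: "optimal_pairs f g T \<noteq> {}"
  shows "globally_asymptotically_stable (flow_field \<mu> f g T) (optimal_pairs f g T) \<and>
    (\<forall>(x, y) \<in> optimal_pairs f g T.
       is_arg_min (\<lambda>x. ereal (f x) + g (T *v x)) (\<lambda>_. True) x)"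
proof -
  interpret proximal_flow f g T \<mu>
    by standard fact+
  show ?thesis
    using flow_globally_asymptotically_stable optimal_pair_minimizer
    by (simp add: case_prod_beta)
qed

end
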